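(* Let $X$ be a finite set and let $(X,S)$ be a non-degenerate symmetric set-theoretical solution of the quantum Yang-Baxter equation that verifies Property $(\mathcal{C})$. Then the normal subgroup $N(X,S)=\ker(\psi:G(X,S)\to W(X,S))$ is equal to the subgroup $N$ of $G(X,S)$ generated by the frozen elements.
   Context: Let $X$ be a finite set and $S:X\times X\to X\times X$ a bijection; write $S(x,y)=(g_x(y),f_y(x))$ with $g_x,f_y:X\to X$. $(X,S)$ is non-degenerate if all $f_x,g_x$ are bijections; it is symmetric if it is involutive ($S\circ S=\mathrm{Id}$) and braided ($S^{12}S^{23}S^{12}=S^{23}S^{12}S^{23}$ on $X^3$). The structure group $G(X,S)$ has the group presentation $\langle X\mid xy=g_x(y)f_y(x);\ x,y\in X,\ S(x,y)\ne(x,y)\rangle$. A pair $(x,y)\in X\times X$ is frozen if $S(x,y)=(x,y)$; then the element $xy$ of $G(X,S)$ is called a frozen element. $(X,S)$ verifies Property $(\mathcal{C})$ if for every frozen pair $(x,y)$ one has $g_x\circ g_y=\mathrm{Id}_X$ and $f_y\circ f_x=\mathrm{Id}_X$. Let $V$ be the real vector space with basis $X$ and $\phi_x=f_x^{-1}$. For $x\in X$, $\psi_x\in GL(V)$ is the linear map with $\psi_x(y)=\phi_x(y)$ for $y\in X$, $y\ne x$, and $\psi_x(x)=-\phi_x(x)$. The map $x\mapsto\psi_x$ extends to a group morphism $\psi:G(X,S)\to GL(V)$, and $W(X,S)=\psi(G(X,S))$. *)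

theory Defs
  imports "HOL-Algebra.Bij" "HOL-Algebra.Generated_Groups" "HOL-Analysis.Finite_Function_Topology"
begin

section \<open>Groups given by a presentation\<close>

text \<open>A word over \<open>X\<close> is a list of signed letters: \<open>(x, True)\<close> stands for \<open>x\<close> and
  \<open>(x, False)\<close> for its formal inverse.  A pair \<open>(l, r)\<close> in the set \<open>R\<close> of relations
  stands for the relation \<open>l = r\<close>.\<close>

type_synonym 'a gword = "('a \<times> bool) list"

definition gwords :: "'a set \<Rightarrow> 'a gword set"
  where "gwords X = lists (X \<times> UNIV)"

inductive_set pres_rel :: "'a set \<Rightarrow> ('a gword \<times> 'a gword) set \<Rightarrow> ('a gword \<times> 'a gword) set"
  for X :: "'a set" and R :: "('a gword \<times> 'a gword) set"
  where
    refl: "w \<in> gwords X \<Longrightarrow> (w, w) \<in> pres_rel X R"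
  | sym: "(v, w) \<in> pres_rel X R \<Longrightarrow> (w, v) \<in> pres_rel X R"
  | trans: "\<lbrakk>(u, v) \<in> pres_rel X R; (v, w) \<in> pres_rel X R\<rbrakk> \<Longrightarrow> (u, w) \<in> pres_rel X R"
  | cancel: "\<lbrakk>u \<in> gwords X; v \<in> gwords X; x \<in> X\<rbrakk>
      \<Longrightarrow> (u @ [(x, b), (x, \<not> b)] @ v, u @ v) \<in> pres_rel X R"
  | relation: "\<lbrakk>u \<in> gwords X; v \<in> gwords X; l \<in> gwords X; r \<in> gwords X; (l, r) \<in> R\<rbrakk>
      \<Longrightarrow> (u @ l @ v, u @ r @ v) \<in> pres_rel X R"

definition presented_group :: "'a set \<Rightarrow> ('a gword \<times> 'a gword) set \<Rightarrow> 'a gword set monoid"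
  where "presented_group X R =
    \<lparr>carrier = gwords X // pres_rel X R,
     mult = (\<lambda>A B. \<Union>a\<in>A. \<Union>b\<in>B. pres_rel X R `` {a @ b}),
     one = pres_rel X R `` {[]}\<rparr>"

definition pres_gen :: "'a set \<Rightarrow> ('a gword \<times> 'a gword) set \<Rightarrow> 'a \<Rightarrow> 'a gword set"
  where "pres_gen X R x = pres_rel X R `` {[(x, True)]}"

definition eval_gword :: "('b, 'c) monoid_scheme \<Rightarrow> ('a \<Rightarrow> 'b) \<Rightarrow> 'a gword \<Rightarrow> 'b"
  where "eval_gword H h w =
    foldr (\<lambda>(x, b) t. (if b then h x else inv\<^bsub>H\<^esub> (h x)) \<otimes>\<^bsub>H\<^esub> t) w \<one>\<^bsub>H\<^esub>"

text \<open>The morphism to \<open>H\<close> extending a map \<open>h\<close> on the generators.  It is meaningful when \<open>h\<close>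
  respects the relations, so that all words in a class have the same value; see
  \<open>pres_lift_hom\<close>, \<open>pres_lift_gen\<close> and \<open>pres_lift_unique\<close> below.\<close>

definition pres_lift :: "('b, 'c) monoid_scheme \<Rightarrow> ('a \<Rightarrow> 'b) \<Rightarrow> 'a gword set \<Rightarrow> 'b"
  where "pres_lift H h C = the_elem (eval_gword H h ` C)"

lemma gwords_simps [simp]:
  "[] \<in> gwords X"
  "p # w \<in> gwords X \<longleftrightarrow> fst p \<in> X \<and> w \<in> gwords X"
  "u @ v \<in> gwords X \<longleftrightarrow> u \<in> gwords X \<and> v \<in> gwords X"
  by (auto simp: gwords_def mem_Times_iff)

lemma pres_rel_gwords: "(u, v) \<in> pres_rel X R \<Longrightarrow> u \<in> gwords X \<and> v \<in> gwords X"
  by (induction rule: pres_rel.induct) auto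

lemma equiv_pres_rel: "equiv (gwords X) (pres_rel X R)"
proof (rule equivI)
  show "pres_rel X R \<subseteq> gwords X \<times> gwords X" using pres_rel_gwords by fast
  show "refl_on (gwords X) (pres_rel X R)"
    by (rule refl_onI) (auto intro: pres_rel.refl)
  show "Relation.sym (pres_rel X R)" by (rule symI) (rule pres_rel.sym)
  show "Relation.trans (pres_rel X R)" by (rule transI) (rule pres_rel.trans)
qed

lemma pres_rel_ctxt:
  "(u, v) \<in> pres_rel X R \<Longrightarrow> a \<in> gwords X \<Longrightarrow> b \<in> gwords X
    \<Longrightarrow> (a @ u @ b, a @ v @ b) \<in> pres_rel X R"
proof (induction rule: pres_rel.induct)
  case (cancel u v x c)
  then show ?case using pres_rel.cancel[of "a @ u" X "v @ b" x c R] by simp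
next
  case (relation u v l r)
  then show ?case using pres_rel.relation[of "a @ u" X "v @ b" l r R] by simp
qed (auto intro: pres_rel.refl pres_rel.sym pres_rel.trans)

lemma pres_rel_append:
  assumes "(u, u') \<in> pres_rel X R" "(v, v') \<in> pres_rel X R"
  shows "(u @ v, u' @ v') \<in> pres_rel X R"
  using pres_rel_ctxt[OF assms(1), of "[]" v] pres_rel_ctxt[OF assms(2), of u' "[]"]
    pres_rel_gwords[OF assms(1)] pres_rel_gwords[OF assms(2)]
  by (auto intro: pres_rel.trans)

lemma presented_group_mult:
  assumes "a \<in> gwords X" "b \<in> gwords X"
  shows "pres_rel X R `` {a} \<otimes>\<^bsub>presented_group X R\<^esub> pres_rel X R `` {b} = pres_rel X R `` {a @ b}"
proof -
  let ?A = "pres_rel X R `` {a}" and ?B = "pres_rel X R `` {b}"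
  have *: "pres_rel X R `` {a' @ b'} = pres_rel X R `` {a @ b}"
    if "a' \<in> ?A" "b' \<in> ?B" for a' b'
    using equiv_class_eq[OF equiv_pres_rel pres_rel_append[of a a' X R b b']] that by simp
  have "a \<in> ?A" "b \<in> ?B"
    using assms by (auto intro: pres_rel.refl)
  then have ne: "?A \<noteq> {}" "?B \<noteq> {}" by (metis empty_iff)+
  have **: "(\<Union>a'\<in>?A. \<Union>b'\<in>?B. pres_rel X R `` {a' @ b'})
      = (\<Union>a'\<in>?A. \<Union>b'\<in>?B. pres_rel X R `` {a @ b})"
    by (intro SUP_cong HOL.refl *)
  show ?thesis
    by (simp only: presented_group_def monoid.simps ** UN_constant ne if_False)
qed

lemma presented_group_carrierE:
  assumes "A \<in> carrier (presented_group X R)"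
  obtains a where "a \<in> gwords X" "A = pres_rel X R `` {a}"
  using assms that unfolding presented_group_def partial_object.simps by (rule quotientE)

lemma presented_group_carrierI:
  "a \<in> gwords X \<Longrightarrow> pres_rel X R `` {a} \<in> carrier (presented_group X R)"
  by (simp add: presented_group_def quotientI)

lemma pres_rel_left_inv:
  "w \<in> gwords X \<Longrightarrow> (rev (map (\<lambda>(x, b). (x, \<not> b)) w) @ w, []) \<in> pres_rel X R"
proof (induction w)
  case Nil
  then show ?case by (simp add: pres_rel.refl)
next
  case (Cons p w)
  obtain x b where p: "p = (x, b)" by force
  let ?v = "rev (map (\<lambda>(x, b). (x, \<not> b)) w)"
  have v: "?v \<in> gwords X" using Cons.prems by (auto simp: gwords_def)
  have "(?v @ [(x, \<not> b), (x, b)] @ w, ?v @ w) \<in> pres_rel X R"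
    using pres_rel.cancel[OF v, of w x "\<not> b" R] Cons.prems p by simp
  with Cons.IH Cons.prems show ?case by (auto simp: p intro: pres_rel.trans)
qed

lemma group_presented_group: "group (presented_group X R)"
proof (rule groupI)
  let ?G = "presented_group X R"
  have one: "\<one>\<^bsub>?G\<^esub> = pres_rel X R `` {[]}" by (simp add: presented_group_def)
  show "\<one>\<^bsub>?G\<^esub> \<in> carrier ?G" by (simp add: one presented_group_carrierI)
  fix A assume "A \<in> carrier ?G"
  then obtain a where a: "a \<in> gwords X" "A = pres_rel X R `` {a}"
    by (rule presented_group_carrierE)
  show "\<one>\<^bsub>?G\<^esub> \<otimes>\<^bsub>?G\<^esub> A = A" by (simp add: one a presented_group_mult)
  let ?v = "rev (map (\<lambda>(x, b). (x, \<not> b)) a)"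
  have v: "?v \<in> gwords X" using a by (auto simp: gwords_def)
  have "pres_rel X R `` {?v} \<otimes>\<^bsub>?G\<^esub> A = \<one>\<^bsub>?G\<^esub>"
    unfolding one a(2) presented_group_mult[OF v a(1)]
    by (rule equiv_class_eq[OF equiv_pres_rel pres_rel_left_inv[OF a(1)]])
  with v show "\<exists>B\<in>carrier ?G. B \<otimes>\<^bsub>?G\<^esub> A = \<one>\<^bsub>?G\<^esub>"
    using presented_group_carrierI by blast
  fix B assume "B \<in> carrier ?G"
  then obtain b where b: "b \<in> gwords X" "B = pres_rel X R `` {b}"
    by (rule presented_group_carrierE)
  show "A \<otimes>\<^bsub>?G\<^esub> B \<in> carrier ?G"
    by (simp add: a b presented_group_mult presented_group_carrierI)
  fix C assume "C \<in> carrier ?G"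
  then obtain c where c: "c \<in> gwords X" "C = pres_rel X R `` {c}"
    by (rule presented_group_carrierE)
  show "A \<otimes>\<^bsub>?G\<^esub> B \<otimes>\<^bsub>?G\<^esub> C = A \<otimes>\<^bsub>?G\<^esub> (B \<otimes>\<^bsub>?G\<^esub> C)"
    by (simp add: a b c presented_group_mult)
qed

lemma eval_gword_simps [simp]:
  "eval_gword H h [] = \<one>\<^bsub>H\<^esub>"
  "eval_gword H h ((x, b) # w) =
    (if b then h x else inv\<^bsub>H\<^esub> (h x)) \<otimes>\<^bsub>H\<^esub> eval_gword H h w"
  by (auto simp: eval_gword_def)

context
  fixes X :: "'a set" and R :: "('a gword \<times> 'a gword) set"
    and H :: "('b, 'c) monoid_scheme" and h :: "'a \<Rightarrow> 'b"
  assumes H: "group H"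
    and h: "h \<in> X \<rightarrow> carrier H"
begin

interpretation H: group H by (rule H)

lemma eval_gword_closed: "w \<in> gwords X \<Longrightarrow> eval_gword H h w \<in> carrier H"
  using h by (induction w) (auto simp: Pi_iff)

lemma eval_gword_append:
  "u \<in> gwords X \<Longrightarrow> v \<in> gwords X
    \<Longrightarrow> eval_gword H h (u @ v) = eval_gword H h u \<otimes>\<^bsub>H\<^esub> eval_gword H h v"
proof (induction u)
  case Nil
  then show ?case by (simp add: eval_gword_closed)
next
  case (Cons p u)
  then have "h (fst p) \<in> carrier H" using h by auto
  then show ?case using Cons
    by (cases p) (auto simp: H.m_assoc eval_gword_closed)
qed

context
  assumes R: "\<And>l r. (l, r) \<in> R \<Longrightarrow> l \<in> gwords X \<Longrightarrow> r \<in> gwords X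
    \<Longrightarrow> eval_gword H h l = eval_gword H h r"
begin

lemma eval_gword_pres_rel:
  "(u, v) \<in> pres_rel X R \<Longrightarrow> eval_gword H h u = eval_gword H h v"
proof (induction rule: pres_rel.induct)
  case (cancel u v x b)
  then have x: "h x \<in> carrier H" using h by auto
  have "eval_gword H h [(x, b), (x, \<not> b)] = \<one>\<^bsub>H\<^esub>"
    using x by auto
  moreover have "[(x, b), (x, \<not> b)] \<in> gwords X" using cancel by simp
  ultimately show ?case
    using cancel x by (simp add: eval_gword_append eval_gword_closed del: eval_gword_simps append_Cons)
next
  case (relation u v l r)
  then show ?case by (simp add: eval_gword_append R)
qed auto

lemma pres_lift_class:
  assumes "w \<in> gwords X"
  shows "pres_lift H h (pres_rel X R `` {w}) = eval_gword H h w"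
proof -
  have "eval_gword H h ` (pres_rel X R `` {w}) = {eval_gword H h w}"
    using eval_gword_pres_rel pres_rel.refl[OF assms] by force
  then show ?thesis by (simp add: pres_lift_def)
qed

lemma pres_lift_gen: "x \<in> X \<Longrightarrow> pres_lift H h (pres_gen X R x) = h x"
  using h by (auto simp: pres_gen_def pres_lift_class Pi_iff)

lemma pres_lift_hom: "pres_lift H h \<in> hom (presented_group X R) H"
  by (rule homI)
    (auto elim!: presented_group_carrierE
      simp: pres_lift_class presented_group_mult eval_gword_append eval_gword_closed)

end
end

lemma pres_lift_unique:
  fixes X :: "'a set"
  assumes H: "group H" and k: "k \<in> hom (presented_group X R) H"
    and c: "c \<in> carrier (presented_group X R)"
  shows "k c = pres_lift H (\<lambda>x. k (pres_gen X R x)) c"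
proof -
  let ?G = "presented_group X R" and ?h = "\<lambda>x. k (pres_gen X R x)"
  interpret group_hom ?G H k
    using H k by (auto simp: group_hom_def group_hom_axioms_def group_presented_group)
  have gen: "x \<in> X \<Longrightarrow> pres_gen X R x \<in> carrier ?G" for x
    by (simp add: pres_gen_def presented_group_carrierI)
  have inv_gen: "pres_rel X R `` {[(x, False)]} = inv\<^bsub>?G\<^esub> (pres_gen X R x)" if "x \<in> X" for x
  proof (rule G.inv_equality[symmetric])
    show "pres_rel X R `` {[(x, False)]} \<otimes>\<^bsub>?G\<^esub> pres_gen X R x = \<one>\<^bsub>?G\<^esub>"
    proof -
      have "pres_rel X R `` {[(x, False), (x, True)]} = \<one>\<^bsub>?G\<^esub>"
        using that equiv_class_eq[OF equiv_pres_rel pres_rel.cancel[of "[]" X "[]" x False R]]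
        by (simp add: presented_group_def)
      then show ?thesis
        using that by (simp add: pres_gen_def presented_group_mult)
    qed
  qed (use that in \<open>auto simp: pres_gen_def presented_group_carrierI\<close>)
  have *: "w \<in> gwords X \<Longrightarrow> k (pres_rel X R `` {w}) = eval_gword H ?h w" for w
  proof (induction w)
    case Nil
    have "pres_rel X R `` {[]} = \<one>\<^bsub>?G\<^esub>" by (simp add: presented_group_def)
    then show ?case by simp
  next
    case (Cons p w)
    obtain x b where p: "p = (x, b)" by force
    have "pres_rel X R `` {p # w} = pres_rel X R `` {[p]} \<otimes>\<^bsub>?G\<^esub> pres_rel X R `` {w}"
      using Cons.prems presented_group_mult[of "[p]" X w R] by simp
    moreover have "pres_rel X R `` {[p]} =
        (if b then pres_gen X R x else inv\<^bsub>?G\<^esub> (pres_gen X R x))"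
      using Cons.prems p inv_gen by (simp add: pres_gen_def)
    ultimately show ?case
      using Cons p gen[of x] by (simp add: presented_group_carrierI)
  qed
  obtain w where w: "w \<in> gwords X" "c = pres_rel X R `` {w}"
    using c by (rule presented_group_carrierE)
  have "eval_gword H ?h ` c = {k c}"
  proof -
    have "eval_gword H ?h v = k c" if "v \<in> c" for v
      using that w * pres_rel_gwords[of w v X R] equiv_class_eq[OF equiv_pres_rel, of w v X R]
      by auto
    moreover have "w \<in> c" using w pres_rel.refl by auto
    ultimately show ?thesis by force
  qed
  then show ?thesis by (simp add: pres_lift_def)
qed


section \<open>Set-theoretical solutions\<close>

text \<open>\<open>S (x, y) = (g\<^sub>x y, f\<^sub>y x)\<close>: note that in the second component the index is the second
  argument.\<close>

definition sol_g :: "('a \<times> 'a \<Rightarrow> 'a \<times> 'a) \<Rightarrow> 'a \<Rightarrow> 'a \<Rightarrow> 'a"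
  where "sol_g S x y = fst (S (x, y))"

definition sol_f :: "('a \<times> 'a \<Rightarrow> 'a \<times> 'a) \<Rightarrow> 'a \<Rightarrow> 'a \<Rightarrow> 'a"
  where "sol_f S y x = snd (S (x, y))"

definition nondegenerate :: "'a set \<Rightarrow> ('a \<times> 'a \<Rightarrow> 'a \<times> 'a) \<Rightarrow> bool"
  where "nondegenerate X S \<longleftrightarrow>
    (\<forall>x\<in>X. bij_betw (sol_f S x) X X \<and> bij_betw (sol_g S x) X X)"

definition involutive :: "'a set \<Rightarrow> ('a \<times> 'a \<Rightarrow> 'a \<times> 'a) \<Rightarrow> bool"
  where "involutive X S \<longleftrightarrow> (\<forall>p\<in>X \<times> X. S (S p) = p)"

definition act12 :: "('a \<times> 'a \<Rightarrow> 'a \<times> 'a) \<Rightarrow> 'a \<times> 'a \<times> 'a \<Rightarrow> 'a \<times> 'a \<times> 'a"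
  where "act12 S = (\<lambda>(x, y, z). case S (x, y) of (x', y') \<Rightarrow> (x', y', z))"

definition act23 :: "('a \<times> 'a \<Rightarrow> 'a \<times> 'a) \<Rightarrow> 'a \<times> 'a \<times> 'a \<Rightarrow> 'a \<times> 'a \<times> 'a"
  where "act23 S = (\<lambda>(x, y, z). case S (y, z) of (y', z') \<Rightarrow> (x, y', z'))"

definition braided :: "'a set \<Rightarrow> ('a \<times> 'a \<Rightarrow> 'a \<times> 'a) \<Rightarrow> bool"
  where "braided X S \<longleftrightarrow> (\<forall>t\<in>X \<times> X \<times> X.
    act12 S (act23 S (act12 S t)) = act23 S (act12 S (act23 S t)))"

definition nondegenerate_symmetric_solution :: "'a set \<Rightarrow> ('a \<times> 'a \<Rightarrow> 'a \<times> 'a) \<Rightarrow> bool"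
  where "nondegenerate_symmetric_solution X S \<longleftrightarrow>
    bij_betw S (X \<times> X) (X \<times> X) \<and> nondegenerate X S \<and> involutive X S \<and> braided X S"

definition frozen_pairs :: "'a set \<Rightarrow> ('a \<times> 'a \<Rightarrow> 'a \<times> 'a) \<Rightarrow> ('a \<times> 'a) set"
  where "frozen_pairs X S = {(x, y). x \<in> X \<and> y \<in> X \<and> S (x, y) = (x, y)}"

definition property_C :: "'a set \<Rightarrow> ('a \<times> 'a \<Rightarrow> 'a \<times> 'a) \<Rightarrow> bool"
  where "property_C X S \<longleftrightarrow> (\<forall>(x, y)\<in>frozen_pairs X S. \<forall>z\<in>X.
    sol_g S x (sol_g S y z) = z \<and> sol_f S y (sol_f S x z) = z)"


section \<open>The structure group\<close>

definition structure_relations ::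
    "'a set \<Rightarrow> ('a \<times> 'a \<Rightarrow> 'a \<times> 'a) \<Rightarrow> ('a gword \<times> 'a gword) set"
  where "structure_relations X S =
    {([(x, True), (y, True)], [(sol_g S x y, True), (sol_f S y x, True)]) | x y.
      x \<in> X \<and> y \<in> X \<and> S (x, y) \<noteq> (x, y)}"

definition structure_group :: "'a set \<Rightarrow> ('a \<times> 'a \<Rightarrow> 'a \<times> 'a) \<Rightarrow> 'a gword set monoid"
  where "structure_group X S = presented_group X (structure_relations X S)"

definition structure_gen :: "'a set \<Rightarrow> ('a \<times> 'a \<Rightarrow> 'a \<times> 'a) \<Rightarrow> 'a \<Rightarrow> 'a gword set"
  where "structure_gen X S x = pres_gen X (structure_relations X S) x"

definition frozen_elements :: "'a set \<Rightarrow> ('a \<times> 'a \<Rightarrow> 'a \<times> 'a) \<Rightarrow> 'a gword set set"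
  where "frozen_elements X S =
    {structure_gen X S x \<otimes>\<^bsub>structure_group X S\<^esub> structure_gen X S y | x y.
      (x, y) \<in> frozen_pairs X S}"


section \<open>The linear representation\<close>

text \<open>The basis vector of the free real vector space attached to \<open>x\<close>.\<close>

abbreviation basis_vec :: "'a \<Rightarrow> ('a \<Rightarrow>\<^sub>0 real)"
  where "basis_vec x \<equiv> Poly_Mapping.single x 1"

definition free_space :: "'a set \<Rightarrow> ('a \<Rightarrow>\<^sub>0 real) set"
  where "free_space X = span (basis_vec ` X)"

text \<open>\<open>BijGroup V\<close> consists of the bijections of \<open>V\<close> that are extensional, i.e. take the dummy
  value \<open>undefined\<close> outside \<open>V\<close>; its product is composition.\<close>

definition GL :: "'b::real_vector set \<Rightarrow> ('b \<Rightarrow> 'b) monoid"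
  where "GL V = (BijGroup V)\<lparr>carrier :=
    {T \<in> Bij V. (\<forall>u\<in>V. \<forall>v\<in>V. T (u + v) = T u + T v) \<and> (\<forall>c. \<forall>v\<in>V. T (c *\<^sub>R v) = c *\<^sub>R T v)}\<rparr>"

definition sol_phi :: "'a set \<Rightarrow> ('a \<times> 'a \<Rightarrow> 'a \<times> 'a) \<Rightarrow> 'a \<Rightarrow> 'a \<Rightarrow> 'a"
  where "sol_phi X S x = inv_into X (sol_f S x)"

definition psi_gen ::
    "'a set \<Rightarrow> ('a \<times> 'a \<Rightarrow> 'a \<times> 'a) \<Rightarrow> 'a \<Rightarrow> ('a \<Rightarrow>\<^sub>0 real) \<Rightarrow> ('a \<Rightarrow>\<^sub>0 real)"
  where "psi_gen X S x = (\<lambda>v\<in>free_space X. \<Sum>y\<in>X. Poly_Mapping.lookup v y *\<^sub>R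
    (if y = x then - basis_vec (sol_phi X S x y) else basis_vec (sol_phi X S x y)))"

definition psi ::
    "'a set \<Rightarrow> ('a \<times> 'a \<Rightarrow> 'a \<times> 'a) \<Rightarrow> 'a gword set \<Rightarrow> ('a \<Rightarrow>\<^sub>0 real) \<Rightarrow> ('a \<Rightarrow>\<^sub>0 real)"
  where "psi X S = pres_lift (GL (free_space X)) (psi_gen X S)"

definition W_group ::
    "'a set \<Rightarrow> ('a \<times> 'a \<Rightarrow> 'a \<times> 'a) \<Rightarrow> (('a \<Rightarrow>\<^sub>0 real) \<Rightarrow> ('a \<Rightarrow>\<^sub>0 real)) monoid"
  where "W_group X S = (GL (free_space X))\<lparr>carrier := psi X S ` carrier (structure_group X S)\<rparr>"

definition N_kernel :: "'a set \<Rightarrow> ('a \<times> 'a \<Rightarrow> 'a \<times> 'a) \<Rightarrow> 'a gword set set"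
  where "N_kernel X S = kernel (structure_group X S) (W_group X S) (psi X S)"


subsection \<open>The representation is well defined\<close>

lemma lookup_scaleR [simp]:
  "Poly_Mapping.lookup (c *\<^sub>R v) x = c *\<^sub>R Poly_Mapping.lookup v x"
proof -
  have "finite {i. c *\<^sub>R Poly_Mapping.lookup v i \<noteq> 0}"
    by (rule finite_subset[OF _ finite_keys[of v]]) (auto simp: in_keys_iff)
  then show ?thesis by (simp add: scaleR_poly_mapping_def)
qed

lemma poly_mapping_eq_sum_basis:
  assumes "finite X" "Poly_Mapping.keys v \<subseteq> X"
  shows "v = (\<Sum>x\<in>X. Poly_Mapping.lookup v x *\<^sub>R basis_vec x)"
proof (rule poly_mapping_eqI)
  fix y
  show "Poly_Mapping.lookup v y =
      Poly_Mapping.lookup (\<Sum>x\<in>X. Poly_Mapping.lookup v x *\<^sub>R basis_vec x) y"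
    using assms by (auto simp: lookup_sum lookup_single when_def if_distrib in_keys_iff cong: if_cong)
qed

lemma free_space_eq_keys:
  assumes "finite X"
  shows "free_space X = {v. Poly_Mapping.keys v \<subseteq> X}"
proof
  have "subspace {v :: 'a \<Rightarrow>\<^sub>0 real. Poly_Mapping.keys v \<subseteq> X}"
    by (rule subspaceI) (auto simp: in_keys_iff lookup_add subset_iff, metis add_0)
  then show "free_space X \<subseteq> {v. Poly_Mapping.keys v \<subseteq> X}"
    unfolding free_space_def by (intro span_minimal) auto
  show "{v. Poly_Mapping.keys v \<subseteq> X} \<subseteq> free_space X"
  proof
    fix v :: "'a \<Rightarrow>\<^sub>0 real" assume "v \<in> {v. Poly_Mapping.keys v \<subseteq> X}"
    then have "v = (\<Sum>x\<in>X. Poly_Mapping.lookup v x *\<^sub>R basis_vec x)"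
      using assms by (intro poly_mapping_eq_sum_basis) auto
    also have "\<dots> \<in> free_space X"
      unfolding free_space_def by (intro span_sum span_scale span_base) auto
    finally show "v \<in> free_space X" .
  qed
qed

lemma subgroup_GL:
  assumes V: "subspace V"
  shows "subgroup (carrier (GL V)) (BijGroup V)"
proof (rule group.subgroupI[OF group_BijGroup])
  show "carrier (GL V) \<subseteq> carrier (BijGroup V)" by (auto simp: GL_def BijGroup_def)
  have "(\<lambda>x\<in>V. x) \<in> carrier (GL V)"
    using V by (auto simp: GL_def id_Bij subspace_add subspace_scale)
  then show "carrier (GL V) \<noteq> {}" by blast
next
  fix T assume T: "T \<in> carrier (GL V)"
  then have B: "T \<in> Bij V" by (simp add: GL_def)
  then have bij: "bij_betw T V V" by (simp add: Bij_def)
  let ?I = "\<lambda>x\<in>V. inv_into V T x"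
  have I: "inv_into V T x \<in> V" "T (inv_into V T x) = x" if "x \<in> V" for x
    using bij that by (auto simp: bij_betw_def inv_into_into f_inv_into_f)
  have IT: "inv_into V T (T x) = x" if "x \<in> V" for x
    using bij that by (auto simp: bij_betw_def)
  have "?I (u + v) = ?I u + ?I v" if "u \<in> V" "v \<in> V" for u v
  proof -
    have "T (inv_into V T u + inv_into V T v) = u + v"
      using T that by (simp add: GL_def I)
    moreover have "inv_into V T u + inv_into V T v \<in> V" "u + v \<in> V"
      using that V by (auto simp: I subspace_add)
    ultimately show ?thesis using that IT by (metis restrict_apply')
  qed
  moreover have "?I (c *\<^sub>R v) = c *\<^sub>R ?I v" if "v \<in> V" for c v
  proof -
    have "T (c *\<^sub>R inv_into V T v) = c *\<^sub>R v"
      using T that by (simp add: GL_def I)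
    moreover have "c *\<^sub>R inv_into V T v \<in> V" "c *\<^sub>R v \<in> V"
      using that V by (auto simp: I subspace_scale)
    ultimately show ?thesis using that IT by (metis restrict_apply')
  qed
  ultimately have "?I \<in> carrier (GL V)"
    using restrict_inv_into_Bij[OF B] by (simp add: GL_def)
  then show "inv\<^bsub>BijGroup V\<^esub> T \<in> carrier (GL V)" by (simp add: inv_BijGroup B)
next
  fix T U assume T: "T \<in> carrier (GL V)" and U: "U \<in> carrier (GL V)"
  then have B: "T \<in> Bij V" "U \<in> Bij V" by (auto simp: GL_def)
  then have "\<And>v. v \<in> V \<Longrightarrow> U v \<in> V" by (auto dest: Bij_imp_funcset)
  then have "compose V T U \<in> carrier (GL V)"
    using T U V compose_Bij[OF B] by (auto simp: GL_def compose_def subspace_add subspace_scale)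
  then show "T \<otimes>\<^bsub>BijGroup V\<^esub> U \<in> carrier (GL V)" using B by (simp add: BijGroup_def)
qed

lemma group_GL: "subspace V \<Longrightarrow> group (GL V)"
  using subgroup.subgroup_is_group[OF subgroup_GL group_BijGroup] by (simp add: GL_def)

lemma GL_mult_apply:
  "T \<in> carrier (GL V) \<Longrightarrow> U \<in> carrier (GL V) \<Longrightarrow> T \<otimes>\<^bsub>GL V\<^esub> U = compose V T U"
  by (simp add: GL_def BijGroup_def)

lemma subspace_free_space: "subspace (free_space X)"
  by (simp add: free_space_def)

lemma psi_gen_basis:
  assumes "finite X" "y \<in> X"
  shows "psi_gen X S x (basis_vec y) =
    (if y = x then - basis_vec (sol_phi X S x y) else basis_vec (sol_phi X S x y))"
proof -
  have "basis_vec y \<in> free_space X"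
    using assms by (auto simp: free_space_def intro: span_base)
  then show ?thesis
    using assms by (simp add: psi_gen_def lookup_single when_def if_distrib[of "\<lambda>c. c *\<^sub>R _"] cong: if_cong)
qed

context
  fixes X :: "'a set" and S
  assumes fin: "finite X" and sol: "nondegenerate_symmetric_solution X S"
begin

lemma bij_sol_f: "x \<in> X \<Longrightarrow> bij_betw (sol_f S x) X X"
  using sol by (auto simp: nondegenerate_symmetric_solution_def nondegenerate_def)

lemma sol_closed: "x \<in> X \<Longrightarrow> y \<in> X \<Longrightarrow> sol_g S x y \<in> X \<and> sol_f S y x \<in> X"
  using sol unfolding nondegenerate_symmetric_solution_def nondegenerate_def by (meson bij_betwE)

lemma lookup_psi_gen:
  assumes x: "x \<in> X" and v: "v \<in> free_space X"
  shows "Poly_Mapping.lookup (psi_gen X S x v) z =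
    (if z \<in> X then (if sol_f S x z = x then - 1 else 1) * Poly_Mapping.lookup v (sol_f S x z) else 0)"
proof -
  have b: "bij_betw (sol_f S x) X X" by (rule bij_sol_f[OF x])
  have phi: "sol_phi X S x (sol_f S x y) = y" if "y \<in> X" for y
    using b that by (auto simp: sol_phi_def bij_betw_def)
  let ?t = "\<lambda>y. Poly_Mapping.lookup v y *\<^sub>R
    (if y = x then - basis_vec (sol_phi X S x y) else basis_vec (sol_phi X S x y))"
  have "psi_gen X S x v = (\<Sum>y\<in>X. ?t y)" using v by (simp add: psi_gen_def)
  also have "\<dots> = (\<Sum>y\<in>X. ?t (sol_f S x y))"
    by (rule sum.reindex_bij_betw[OF b, symmetric])
  also have "\<dots> = (\<Sum>y\<in>X. ((if sol_f S x y = x then - 1 else 1) * Poly_Mapping.lookup v (sol_f S x y))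
      *\<^sub>R basis_vec y)"
    by (rule sum.cong[OF HOL.refl], drule phi) auto
  finally have *: "psi_gen X S x v = \<dots>" .
  show ?thesis
    unfolding * using fin
    by (simp add: lookup_sum lookup_single when_def if_distrib[of "\<lambda>c. _ * c"] cong: if_cong)
qed

lemma free_space_lookup: "v \<in> free_space X \<longleftrightarrow> (\<forall>z. z \<notin> X \<longrightarrow> Poly_Mapping.lookup v z = 0)"
  by (auto simp: free_space_eq_keys[OF fin] in_keys_iff)

lemma psi_gen_closed: "x \<in> X \<Longrightarrow> v \<in> free_space X \<Longrightarrow> psi_gen X S x v \<in> free_space X"
  by (simp add: free_space_lookup[of "psi_gen X S x v"] lookup_psi_gen)

lemma psi_gen_GL:
  assumes x: "x \<in> X"
  shows "psi_gen X S x \<in> carrier (GL (free_space X))"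
proof -
  let ?V = "free_space X" and ?T = "psi_gen X S x"
  have b: "bij_betw (sol_f S x) X X" by (rule bij_sol_f[OF x])
  note V = subspace_free_space[of X]
  have ext: "?T \<in> extensional ?V" by (simp add: psi_gen_def)
  have "inj_on ?T ?V"
  proof (rule inj_onI, rule poly_mapping_eqI)
    fix u v z assume u: "u \<in> ?V" and v: "v \<in> ?V" and e: "?T u = ?T v"
    show "Poly_Mapping.lookup u z = Poly_Mapping.lookup v z"
    proof (cases "z \<in> X")
      case True
      then obtain y where y: "y \<in> X" "z = sol_f S x y" using b by (auto simp: bij_betw_def)
      have "Poly_Mapping.lookup (?T u) y = Poly_Mapping.lookup (?T v) y" by (simp add: e)
      then show ?thesis using y by (simp add: lookup_psi_gen x u v split: if_splits)
    next
      case False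
      then show ?thesis using u v by (simp add: free_space_lookup)
    qed
  qed
  moreover have "?T ` ?V = ?V"
  proof
    show "?T ` ?V \<subseteq> ?V" using x by (auto simp: psi_gen_closed)
    show "?V \<subseteq> ?T ` ?V"
    proof
      fix w assume w: "w \<in> ?V"
      define v where "v = (\<Sum>z\<in>X. ((if sol_f S x z = x then - 1 else 1) * Poly_Mapping.lookup w z)
        *\<^sub>R basis_vec (sol_f S x z))"
      have "v \<in> ?V" unfolding v_def free_space_def
        using sol_closed x by (intro span_sum span_scale span_base) auto
      moreover have "?T v = w"
      proof (rule poly_mapping_eqI)
        fix z
        have "Poly_Mapping.lookup v (sol_f S x z) =
            (if sol_f S x z = x then - 1 else 1) * Poly_Mapping.lookup w z" if "z \<in> X"
        proof -
          have "(sol_f S x y = sol_f S x z) = (y = z)" if "y \<in> X" for y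
            using b that \<open>z \<in> X\<close> by (auto simp: bij_betw_def inj_on_def)
          then have "Poly_Mapping.lookup v (sol_f S x z) = (\<Sum>y\<in>X. if y = z then
              (if sol_f S x z = x then - 1 else 1) * Poly_Mapping.lookup w z else 0)"
            unfolding v_def lookup_sum
            by (intro sum.cong) (auto simp: lookup_single when_def)
          then show ?thesis using fin that by simp
        qed
        then show "Poly_Mapping.lookup (?T v) z = Poly_Mapping.lookup w z"
          using w \<open>v \<in> ?V\<close> x by (auto simp: lookup_psi_gen free_space_lookup)
      qed
      ultimately show "w \<in> ?T ` ?V" by blast
    qed
  qed
  moreover have "?T (u + v) = ?T u + ?T v" if "u \<in> ?V" "v \<in> ?V" for u v
    using that V x by (intro poly_mapping_eqI)
      (simp add: lookup_psi_gen subspace_add lookup_add algebra_simps)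
  moreover have "?T (c *\<^sub>R v) = c *\<^sub>R ?T v" if "v \<in> ?V" for c v
    using that V x by (intro poly_mapping_eqI)
      (simp add: lookup_psi_gen subspace_scale)
  ultimately show ?thesis using ext by (simp add: GL_def Bij_def bij_betw_def)
qed

lemma sol_f_comp:
  assumes "x \<in> X" "y \<in> X" "z \<in> X"
  shows "sol_f S y (sol_f S x z) = sol_f S (sol_f S y x) (sol_f S (sol_g S x y) z)"
proof -
  have "act12 S (act23 S (act12 S (z, x, y))) = act23 S (act12 S (act23 S (z, x, y)))"
    using sol assms by (simp add: nondegenerate_symmetric_solution_def braided_def)
  then show ?thesis
    by (auto simp: act12_def act23_def sol_f_def sol_g_def case_prod_beta prod_eq_iff)
qed

lemma sol_f_invol:
  assumes "x \<in> X" "y \<in> X"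
  shows "sol_f S (sol_f S y x) (sol_g S x y) = y"
  using sol assms
  by (simp add: nondegenerate_symmetric_solution_def involutive_def sol_f_def sol_g_def)

lemma psi_gen_relation:
  assumes x: "x \<in> X" and y: "y \<in> X"
  shows "compose (free_space X) (psi_gen X S x) (psi_gen X S y) =
    compose (free_space X) (psi_gen X S (sol_g S x y)) (psi_gen X S (sol_f S y x))"
proof (rule extensionalityI[of _ "free_space X"])
  fix v assume v: "v \<in> free_space X"
  let ?g = "sol_g S x y" and ?h = "sol_f S y x"
  have gh: "?g \<in> X" "?h \<in> X" using sol_closed x y by auto
  have "psi_gen X S x (psi_gen X S y v) = psi_gen X S ?g (psi_gen X S ?h v)"
  proof (rule poly_mapping_eqI)
    fix z
    have "sol_f S x z = x \<longleftrightarrow> sol_f S ?h (sol_f S ?g z) = ?h" if z: "z \<in> X"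
      using bij_sol_f[OF y] sol_closed z x sol_f_comp[OF x y z]
      by (metis bij_betw_imp_inj_on inj_onD)
    moreover have "sol_f S y (sol_f S x z) = y \<longleftrightarrow> sol_f S ?g z = ?g" if z: "z \<in> X"
      using bij_sol_f[OF gh(2)] sol_closed z gh sol_f_comp[OF x y z] sol_f_invol[OF x y]
      by (metis bij_betw_imp_inj_on inj_onD)
    ultimately show "Poly_Mapping.lookup (psi_gen X S x (psi_gen X S y v)) z =
        Poly_Mapping.lookup (psi_gen X S ?g (psi_gen X S ?h v)) z"
      using v x y gh sol_closed by (auto simp: lookup_psi_gen psi_gen_closed sol_f_comp[OF x y])
  qed
  then show "compose (free_space X) (psi_gen X S x) (psi_gen X S y) v =
      compose (free_space X) (psi_gen X S ?g) (psi_gen X S ?h) v"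
    using v by (simp add: compose_def)
qed (simp_all only: compose_extensional)

lemma psi_gen_respects:
  assumes "(l, r) \<in> structure_relations X S"
  shows "eval_gword (GL (free_space X)) (psi_gen X S) l =
    eval_gword (GL (free_space X)) (psi_gen X S) r"
proof -
  let ?H = "GL (free_space X)"
  interpret H: group ?H by (rule group_GL[OF subspace_free_space])
  from assms obtain x y where xy: "x \<in> X" "y \<in> X" "l = [(x, True), (y, True)]"
    "r = [(sol_g S x y, True), (sol_f S y x, True)]"
    by (auto simp: structure_relations_def)
  then show ?thesis
    using sol_closed[of x y] psi_gen_relation[of x y]
    by (simp add: psi_gen_GL GL_mult_apply)
qed

theorem psi_hom: "psi X S \<in> hom (structure_group X S) (GL (free_space X))"
  unfolding psi_def structure_group_def
  by (rule pres_lift_hom[OF group_GL[OF subspace_free_space]])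
    (auto simp: psi_gen_GL psi_gen_respects)

theorem psi_structure_gen: "x \<in> X \<Longrightarrow> psi X S (structure_gen X S x) = psi_gen X S x"
  unfolding psi_def structure_gen_def
  by (rule pres_lift_gen[OF group_GL[OF subspace_free_space]])
    (auto simp: psi_gen_GL psi_gen_respects)

theorem normal_N_kernel: "N_kernel X S \<lhd> structure_group X S"
proof -
  interpret group_hom "structure_group X S" "GL (free_space X)" "psi X S"
    using psi_hom by (simp add: group_hom_def group_hom_axioms_def structure_group_def
        group_presented_group group_GL subspace_free_space)
  show ?thesis
    using normal_kernel by (simp add: N_kernel_def W_group_def kernel_def)
qed

end

end

theory Submission
  imports Defs "HOL-Library.Multiset"
begin

text \<open>Every list \<open>ys\<close> over \<open>X\<close> yields a positive word of the structure group by
  \<open>K (y # ys) = K (map \<phi>\<^sub>y ys) y\<close>.  Exchanging adjacent entries of the list amounts to applying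
  a defining relation to the word, so \<open>K\<close> depends only on the multiset of its argument (it inverts
  the bijective 1-cocycle of the structure group on positive words), and \<open>\<psi> (K ys)\<close> sends
  the basis vector \<open>z\<close> to a basis vector with sign \<open>(-1)^(count z ys)\<close>.  The frozen elements are
  the \<open>K [y, y]\<close>; under Property (C) a repeated entry splits off as a frozen factor and every inverse
  generator is a generator up to a frozen element.  So each group element is \<open>n K ys\<close> with \<open>n\<close> in the
  subgroup generated by the frozen elements, and if it acts trivially then all multiplicities
  in \<open>ys\<close> are even, whence \<open>K ys\<close> is a product of frozen elements.\<close>

function cocycle_word :: "'a set \<Rightarrow> ('a \<times> 'a \<Rightarrow> 'a \<times> 'a) \<Rightarrow> 'a list \<Rightarrow> 'a gword set"
  where
    "cocycle_word X S [] = \<one>\<^bsub>structure_group X S\<^esub>"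
  | "cocycle_word X S (y # ys) =
      cocycle_word X S (map (sol_phi X S y) ys) \<otimes>\<^bsub>structure_group X S\<^esub> structure_gen X S y"
  by pat_completeness auto
termination by (relation "measure (\<lambda>(X, S, ys). length ys)") auto

section \<open>Generators of the structure group and induction over its elements\<close>

lemma structure_gen_carrier: "x \<in> X \<Longrightarrow> structure_gen X S x \<in> carrier (structure_group X S)"
  by (simp add: structure_gen_def structure_group_def pres_gen_def presented_group_carrierI)

lemma group_structure_group: "group (structure_group X S)"
  by (simp add: structure_group_def group_presented_group)

text \<open>Words are built by appending letters on the right because \<open>cocycle_word\<close>
  puts its new generator on the right; this is the side on which the decomposition below absorbs a
  letter.\<close>

lemma structure_group_induct [consumes 1, case_names one gen inv]:
  assumes "A \<in> carrier (structure_group X S)"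
    and "P \<one>\<^bsub>structure_group X S\<^esub>"
    and "\<And>A x. A \<in> carrier (structure_group X S) \<Longrightarrow> P A \<Longrightarrow> x \<in> X
      \<Longrightarrow> P (A \<otimes>\<^bsub>structure_group X S\<^esub> structure_gen X S x)"
    and "\<And>A x. A \<in> carrier (structure_group X S) \<Longrightarrow> P A \<Longrightarrow> x \<in> X
      \<Longrightarrow> P (A \<otimes>\<^bsub>structure_group X S\<^esub> inv\<^bsub>structure_group X S\<^esub> (structure_gen X S x))"
  shows "P A"
proof -
  let ?G = "structure_group X S" and ?R = "structure_relations X S"
  interpret G: group ?G by (rule group_structure_group)
  have one: "\<one>\<^bsub>?G\<^esub> = pres_rel X ?R `` {[]}"
    by (simp add: structure_group_def presented_group_def)
  have mult: "pres_rel X ?R `` {a @ b} = pres_rel X ?R `` {a} \<otimes>\<^bsub>?G\<^esub> pres_rel X ?R `` {b}"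
    if "a \<in> gwords X" "b \<in> gwords X" for a b
    using presented_group_mult[OF that] by (simp add: structure_group_def)
  have cl: "a \<in> gwords X \<Longrightarrow> pres_rel X ?R `` {a} \<in> carrier ?G" for a
    by (simp add: structure_group_def presented_group_carrierI)
  have inv: "pres_rel X ?R `` {[(x, False)]} = inv\<^bsub>?G\<^esub> (structure_gen X S x)" if x: "x \<in> X" for x
  proof (rule G.inv_equality[symmetric])
    have "([(x, False), (x, True)], []) \<in> pres_rel X ?R"
      using pres_rel.cancel[of "[]" X "[]" x False ?R] x by simp
    then have "pres_rel X ?R `` {[(x, False), (x, True)]} = \<one>\<^bsub>?G\<^esub>"
      unfolding one by (rule equiv_class_eq[OF equiv_pres_rel])
    then show "pres_rel X ?R `` {[(x, False)]} \<otimes>\<^bsub>?G\<^esub> structure_gen X S x = \<one>\<^bsub>?G\<^esub>"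
      using x mult[of "[(x, False)]" "[(x, True)]"] by (simp add: structure_gen_def pres_gen_def)
  qed (use x in \<open>auto simp: cl structure_gen_carrier\<close>)
  have "P (pres_rel X ?R `` {w})" if "w \<in> gwords X" for w
    using that
  proof (induction w rule: rev_induct)
    case Nil
    then show ?case using assms(2) by (simp add: one)
  next
    case (snoc p w)
    obtain x b where p: "p = (x, b)" by force
    from snoc p have w: "w \<in> gwords X" "x \<in> X" by auto
    have "pres_rel X ?R `` {[(x, b)]} =
        (if b then structure_gen X S x else inv\<^bsub>?G\<^esub> (structure_gen X S x))"
      using inv[OF w(2)] by (simp add: structure_gen_def pres_gen_def)
    then show ?case
      using snoc.IH w assms(3,4)[OF cl[OF w(1)]] by (simp add: p mult)
  qed
  then show ?thesis
    using assms(1) unfolding structure_group_def by (metis presented_group_carrierE)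
qed

context
  fixes X :: "'a set" and S :: "'a \<times> 'a \<Rightarrow> 'a \<times> 'a"
  assumes fin: "finite X" and sol: "nondegenerate_symmetric_solution X S"
begin

interpretation G: group "structure_group X S"
  by (rule group_structure_group)

private abbreviation (input) "G \<equiv> structure_group X S"
private abbreviation (input) "gen \<equiv> structure_gen X S"
private abbreviation (input) "\<phi> \<equiv> sol_phi X S"
private abbreviation (input) "K \<equiv> cocycle_word X S"

section \<open>The maps \<phi> and the exchange relation\<close>

lemma bij_sol_phi: "y \<in> X \<Longrightarrow> bij_betw (\<phi> y) X X"
  unfolding sol_phi_def by (rule bij_betw_inv_into[OF bij_sol_f[OF fin sol]])

lemma sol_phi_closed: "y \<in> X \<Longrightarrow> z \<in> X \<Longrightarrow> \<phi> y z \<in> X"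
  using bij_sol_phi by (meson bij_betwE)

lemma sol_f_phi: "y \<in> X \<Longrightarrow> z \<in> X \<Longrightarrow> sol_f S y (\<phi> y z) = z"
  using bij_sol_f[OF fin sol, of y] by (simp add: sol_phi_def bij_betw_inv_into_right)

lemma sol_phi_f: "y \<in> X \<Longrightarrow> z \<in> X \<Longrightarrow> \<phi> y (sol_f S y z) = z"
  using bij_sol_f[OF fin sol, of y] by (simp add: sol_phi_def bij_betw_inv_into_left)

text \<open>Every pair has the form \<open>(\<phi> y z, y)\<close>, and in these coordinates S
  merely exchanges y and z. The second component is z because \<phi> inverts f; by involutivity f at
  z sends the first component back to y.\<close>

lemma sol_phi_swap:
  assumes "y \<in> X" "z \<in> X"
  shows "S (\<phi> y z, y) = (\<phi> z y, z)"
proof -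
  have f: "sol_f S y (\<phi> y z) = z"
    using assms by (rule sol_f_phi)
  then have "sol_f S z (sol_g S (\<phi> y z) y) = y"
    using sol_f_invol[OF fin sol, of "\<phi> y z" y] assms by (simp add: sol_phi_closed)
  then have "sol_g S (\<phi> y z) y = \<phi> z y"
    using sol_phi_f[of z "sol_g S (\<phi> y z) y"] sol_closed[OF fin sol] assms sol_phi_closed by metis
  with f show ?thesis by (simp add: sol_f_def sol_g_def prod_eq_iff)
qed

text \<open>This is the cycle set identity for the operation \<open>\<phi> y z\<close>, namely the
  braid relation for f read backwards.\<close>

lemma sol_phi_comp:
  assumes "y \<in> X" "z \<in> X" "w \<in> X"
  shows "\<phi> (\<phi> y z) (\<phi> y w) = \<phi> (\<phi> z y) (\<phi> z w)"
proof -
  let ?l = "\<phi> (\<phi> y z) (\<phi> y w)" and ?r = "\<phi> (\<phi> z y) (\<phi> z w)"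
  note cl = sol_phi_closed assms
  \<comment> \<open>The braid identity is taken at the pair \<open>(\<phi> y z, y)\<close>, whose
    image under S is \<open>(\<phi> z y, z)\<close>; \<open>?r\<close> is chosen so that the right
    side collapses to w.\<close>
  have "sol_f S y (sol_f S (\<phi> y z) ?r) = sol_f S z (sol_f S (\<phi> z y) ?r)"
    using sol_f_comp[OF fin sol, of "\<phi> y z" y ?r] sol_phi_swap[OF assms(1,2)]
    by (simp add: sol_f_def sol_g_def cl)
  also have "\<dots> = w" by (simp add: sol_f_phi cl)
  finally have "\<phi> (\<phi> y z) (\<phi> y (sol_f S y (sol_f S (\<phi> y z) ?r))) = ?l" by simp
  then show ?thesis
    using sol_closed[OF fin sol] by (simp add: sol_phi_f cl)
qed

lemma structure_gen_swap:
  assumes "y \<in> X" "z \<in> X"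
  shows "gen (\<phi> y z) \<otimes>\<^bsub>G\<^esub> gen y = gen (\<phi> z y) \<otimes>\<^bsub>G\<^esub> gen z"
proof (cases "S (\<phi> y z, y) = (\<phi> y z, y)")
  \<comment> \<open>The presentation has no relation for a frozen pair, but then the two pairs
    coincide and so do the products.\<close>
  case True
  then show ?thesis using sol_phi_swap[OF assms] by simp
next
  case False
  let ?R = "structure_relations X S"
  have "([(\<phi> y z, True), (y, True)], [(\<phi> z y, True), (z, True)]) \<in> ?R"
    unfolding structure_relations_def
    using False assms sol_phi_closed[OF assms] sol_phi_swap[OF assms]
    by (force simp: sol_f_def sol_g_def)
  then have "([(\<phi> y z, True), (y, True)], [(\<phi> z y, True), (z, True)]) \<in> pres_rel X ?R"
    using pres_rel.relation[of "[]" X "[]"] assms by (fastforce simp: sol_phi_closed)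
  then have "pres_rel X ?R `` {[(\<phi> y z, True)] @ [(y, True)]} =
      pres_rel X ?R `` {[(\<phi> z y, True)] @ [(z, True)]}"
    using equiv_class_eq[OF equiv_pres_rel] by simp
  then show ?thesis
    using assms presented_group_mult[of "[(\<phi> y z, True)]" X "[(y, True)]" ?R]
      presented_group_mult[of "[(\<phi> z y, True)]" X "[(z, True)]" ?R]
    by (simp add: structure_gen_def structure_group_def pres_gen_def sol_phi_closed)
qed

section \<open>Invariance of the cocycle word under permutations\<close>

lemma set_map_sol_phi: "y \<in> X \<Longrightarrow> set ys \<subseteq> X \<Longrightarrow> set (map (\<phi> y) ys) \<subseteq> X"
  using sol_phi_closed by auto

lemma cocycle_word_carrier: "set ys \<subseteq> X \<Longrightarrow> K ys \<in> carrier G"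
proof (induction "length ys" arbitrary: ys)
  case (Suc n)
  then obtain y zs where ys: "ys = y # zs" by (cases ys) auto
  with Suc show ?case
    using Suc.hyps(1)[of "map (\<phi> y) zs"] set_map_sol_phi[of y zs] by (simp add: structure_gen_carrier)
qed auto

text \<open>The two rightmost generators are exchanged by \<open>structure_gen_swap\<close>; the
  remaining letters agree by the cycle set identity.\<close>

lemma cocycle_word_swap:
  assumes "y \<in> X" "z \<in> X" "set ys \<subseteq> X"
  shows "K (y # z # ys) = K (z # y # ys)"
proof -
  let ?zs = "map (\<phi> (\<phi> y z)) (map (\<phi> y) ys)"
  have eq: "?zs = map (\<phi> (\<phi> z y)) (map (\<phi> z) ys)"
    using sol_phi_comp assms by auto
  have cl: "K ?zs \<in> carrier G"
    using assms by (intro cocycle_word_carrier set_map_sol_phi sol_phi_closed)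
  have "K (y # z # ys) = K ?zs \<otimes>\<^bsub>G\<^esub> (gen (\<phi> y z) \<otimes>\<^bsub>G\<^esub> gen y)"
    using assms cl by (simp add: G.m_assoc structure_gen_carrier sol_phi_closed)
  also have "\<dots> = K ?zs \<otimes>\<^bsub>G\<^esub> (gen (\<phi> z y) \<otimes>\<^bsub>G\<^esub> gen z)"
    by (simp only: structure_gen_swap[OF assms(1,2)])
  also have "\<dots> = K (z # y # ys)"
    using assms cl unfolding eq by (simp add: G.m_assoc structure_gen_carrier sol_phi_closed)
  finally show ?thesis .
qed

lemma cocycle_word_mset:
  "set ys \<subseteq> X \<Longrightarrow> mset ys = mset zs \<Longrightarrow> K ys = K zs"
proof (induction "length ys" arbitrary: ys zs rule: less_induct)
  case less
  \<comment> \<open>With equal heads the induction hypothesis applies to the images of the tails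
    under \<open>\<phi> x\<close>, which are shorter than \<open>ys\<close>.\<close>
  have step: "K (x # us) = K (x # vs)"
    if "x # us = ys \<or> length us < length ys" "x \<in> X" "set us \<subseteq> X" "mset us = mset vs" for x us vs
  proof -
    have "K (map (\<phi> x) us) = K (map (\<phi> x) vs)"
      using that less.hyps[of "map (\<phi> x) us" "map (\<phi> x) vs"] set_map_sol_phi[of x us] by auto
    then show ?thesis by simp
  qed
  show ?case
  proof (cases ys)
    case Nil
    then show ?thesis using less.prems by simp
  next
    case (Cons y us)
    then obtain z vs where zs: "zs = z # vs" using less.prems by (cases zs) auto
    have XS: "set zs \<subseteq> X" using less.prems by (metis set_mset_mset)
    show ?thesis
    proof (cases "y = z")
      case True
      then show ?thesis using step[of y us vs] less.prems by (simp add: Cons zs)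
    next
      case False
      have "z \<in># mset us"
      proof -
        have "z \<in># mset ys" unfolding less.prems(2) zs by simp
        then show ?thesis using False by (simp add: Cons)
      qed
      \<comment> \<open>\<open>ws\<close> is what remains of both lists without y and z, so that
        \<open>y # z # ws\<close> and \<open>z # y # ws\<close> connect \<open>ys\<close> to
        \<open>zs\<close>.\<close>
      then obtain ws where us: "mset us = mset (z # ws)"
        using that[of "remove1 z us"] by simp
      have "add_mset y (mset us) = add_mset z (mset vs)" using less.prems by (simp add: Cons zs)
      then have vs: "mset vs = mset (y # ws)" using us False by simp
      have W: "set ws \<subseteq> X" using less.prems mset_eq_setD[OF us] by (simp add: Cons)
      have len: "length vs = length us"
        using mset_eq_length[OF less.prems(2)] by (simp add: Cons zs)
      have "K ys = K (y # z # ws)"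
        using less.prems us unfolding Cons by (intro step) (auto simp: Cons)
      also have "\<dots> = K (z # y # ws)"
        using less.prems XS W by (intro cocycle_word_swap) (auto simp: Cons zs)
      also have "\<dots> = K zs"
        using XS vs unfolding zs by (intro step[symmetric]) (auto simp: Cons len)
      finally show ?thesis .
    qed
  qed
qed

section \<open>Frozen elements and the decomposition of group elements\<close>

lemma cocycle_word_pair_frozen: "y \<in> X \<Longrightarrow> K [y, y] \<in> frozen_elements X S"
  using sol_phi_swap[of y y] sol_phi_closed[of y y]
  by (auto simp: frozen_elements_def frozen_pairs_def structure_gen_carrier)

text \<open>A frozen pair (x, y) satisfies f_y(x) = y, which forces
  \<open>x = \<phi> y y\<close>.\<close>

lemma frozen_elementsE:
  assumes "A \<in> frozen_elements X S"
  obtains y where "y \<in> X" "A = K [y, y]"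
proof -
  from assms obtain x y where xy: "x \<in> X" "y \<in> X" "S (x, y) = (x, y)"
      "A = gen x \<otimes>\<^bsub>G\<^esub> gen y"
    by (auto simp: frozen_elements_def frozen_pairs_def)
  then have "x = \<phi> y y" using sol_phi_f[of y x] by (simp add: sol_f_def)
  with xy show ?thesis using that[of y] by (simp add: structure_gen_carrier)
qed

lemma frozen_elements_carrier: "frozen_elements X S \<subseteq> carrier G"
  by (auto elim!: frozen_elementsE intro!: cocycle_word_carrier simp del: cocycle_word.simps)

lemma sol_phi_frozen:
  assumes C: "property_C X S" and y: "y \<in> X" "z \<in> X"
  shows "\<phi> (\<phi> y y) (\<phi> y z) = z"
proof -
  have "(\<phi> y y, y) \<in> frozen_pairs X S"
    using y sol_phi_swap[of y y] by (simp add: frozen_pairs_def sol_phi_closed)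
  then have "sol_f S y (sol_f S (\<phi> y y) z) = z"
    using C y by (force simp: property_C_def)
  then show ?thesis
    using y sol_phi_f[of "\<phi> y y" z] sol_phi_f[of y "sol_f S (\<phi> y y) z"] sol_closed[OF fin sol]
    by (simp add: sol_phi_closed)
qed

text \<open>Reading y twice twists the tail by \<open>\<phi> y\<close> and then by
  \<open>\<phi> (\<phi> y y)\<close>, which together do nothing.\<close>

lemma cocycle_word_frozen:
  assumes "property_C X S" "y \<in> X" "set ys \<subseteq> X"
  shows "K (y # y # ys) = K ys \<otimes>\<^bsub>G\<^esub> K [y, y]"
proof -
  have "map (\<phi> (\<phi> y y)) (map (\<phi> y) ys) = ys"
    using assms by (simp add: map_idI sol_phi_frozen subset_iff)
  then have "K (y # y # ys) = K ys \<otimes>\<^bsub>G\<^esub> gen (\<phi> y y) \<otimes>\<^bsub>G\<^esub> gen y"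
    by simp
  then show ?thesis
    using assms by (simp add: G.m_assoc cocycle_word_carrier structure_gen_carrier sol_phi_closed)
qed

text \<open>Each letter peeled off applies the same bijection to both entries of the final pair, so
  they stay equal. Together with permutation invariance and \<open>cocycle_word_frozen\<close> this
  carries a frozen factor from the right of \<open>K ys\<close> to the left.\<close>

lemma cocycle_word_append_pair:
  "set ys \<subseteq> X \<Longrightarrow> w \<in> X \<Longrightarrow> \<exists>w'\<in>X. K (ys @ [w, w]) = K [w', w'] \<otimes>\<^bsub>G\<^esub> K ys"
proof (induction "length ys" arbitrary: ys w)
  case 0
  then show ?case using cocycle_word_carrier[of "[w, w]"]
    by (intro bexI[of _ w]) (simp_all del: cocycle_word.simps(2))
next
  case (Suc n)
  then obtain y zs where ys: "ys = y # zs" by (cases ys) auto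
  let ?zs = "map (\<phi> y) zs"
  have zs: "set ?zs \<subseteq> X" "\<phi> y w \<in> X" "y \<in> X"
    using Suc.prems sol_phi_closed by (auto simp: ys)
  then obtain w' where w': "w' \<in> X" "K (?zs @ [\<phi> y w, \<phi> y w]) = K [w', w'] \<otimes>\<^bsub>G\<^esub> K ?zs"
    using Suc.hyps(1)[of ?zs "\<phi> y w"] Suc.hyps(2) by (auto simp: ys)
  have "K (ys @ [w, w]) = K [w', w'] \<otimes>\<^bsub>G\<^esub> K ?zs \<otimes>\<^bsub>G\<^esub> gen y"
    using w'(2) by (simp add: ys)
  also have "\<dots> = K [w', w'] \<otimes>\<^bsub>G\<^esub> K ys"
    using zs w'(1) cocycle_word_carrier[of "[w', w']"]
    by (simp add: ys G.m_assoc cocycle_word_carrier structure_gen_carrier sol_phi_closed)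
  finally show ?case using w'(1) by blast
qed

text \<open>The twist by \<open>\<phi> x\<close> is compensated in advance by f_x, so cocycle words
  are closed under right multiplication by generators.\<close>

lemma cocycle_word_snoc_gen:
  assumes "x \<in> X" "set ys \<subseteq> X"
  shows "K ys \<otimes>\<^bsub>G\<^esub> gen x = K (x # map (sol_f S x) ys)"
  using assms by (simp add: map_idI sol_phi_f subset_iff o_def)

lemma structure_group_decomp:
  assumes C: "property_C X S" and A: "A \<in> carrier G"
  shows "\<exists>n\<in>generate G (frozen_elements X S). \<exists>ys. set ys \<subseteq> X \<and> A = n \<otimes>\<^bsub>G\<^esub> K ys"
  using A
proof (induction rule: structure_group_induct)
  case one
  show ?case by (intro bexI[of _ "\<one>\<^bsub>G\<^esub>"] exI[of _ "[]"]) (auto intro: generate.one)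
next
  case (gen A x)
  let ?N = "generate G (frozen_elements X S)"
  have N: "?N \<subseteq> carrier G" by (rule G.generate_incl[OF frozen_elements_carrier])
  from gen obtain n ys where n: "n \<in> ?N" "set ys \<subseteq> X" "A = n \<otimes>\<^bsub>G\<^esub> K ys" by blast
  then have "A \<otimes>\<^bsub>G\<^esub> gen x = n \<otimes>\<^bsub>G\<^esub> K (x # map (sol_f S x) ys)"
    unfolding cocycle_word_snoc_gen[OF gen.hyps(2) n(2), symmetric]
    using gen N by (simp add: G.m_assoc subset_iff cocycle_word_carrier structure_gen_carrier)
  moreover have "set (x # map (sol_f S x) ys) \<subseteq> X"
    using n gen sol_closed[OF fin sol] by auto
  ultimately show ?case using n(1) by blast
next
  case (inv A x)
  let ?N = "generate G (frozen_elements X S)"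
  interpret N: subgroup ?N G by (rule G.generate_is_subgroup[OF frozen_elements_carrier])
  from inv obtain n ys where n: "n \<in> ?N" "set ys \<subseteq> X" "A = n \<otimes>\<^bsub>G\<^esub> K ys" by blast
  let ?x = "\<phi> x x"
  have x: "?x \<in> X" using inv by (simp add: sol_phi_closed)
  have "mset (x # x # ys) = mset (ys @ [x, x])" by simp
  moreover have "set (x # x # ys) \<subseteq> X" using inv n by simp
  ultimately have "K (x # x # ys) = K (ys @ [x, x])" by (rule cocycle_word_mset[rotated])
  then obtain w where w: "w \<in> X" "K ys \<otimes>\<^bsub>G\<^esub> K [x, x] = K [w, w] \<otimes>\<^bsub>G\<^esub> K ys"
    using cocycle_word_append_pair[OF n(2) inv.hyps(2)] cocycle_word_frozen[OF C inv.hyps(2) n(2)] by auto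
  have cl: "K ys \<in> carrier G" "K [w, w] \<in> carrier G" "gen ?x \<in> carrier G" "gen x \<in> carrier G"
    using n w inv x by (auto intro!: cocycle_word_carrier structure_gen_carrier
        simp del: cocycle_word.simps)
  define m where "m = inv\<^bsub>G\<^esub> (K [w, w])"
  have m: "m \<in> ?N" "m \<in> carrier G" unfolding m_def
    using cl cocycle_word_pair_frozen[OF w(1)] by (auto intro: generate.inv simp del: cocycle_word.simps)
  have "m \<otimes>\<^bsub>G\<^esub> (K ys \<otimes>\<^bsub>G\<^esub> gen ?x) \<otimes>\<^bsub>G\<^esub> gen x = m \<otimes>\<^bsub>G\<^esub> (K ys \<otimes>\<^bsub>G\<^esub> K [x, x])"
    using cl m by (simp add: G.m_assoc)
  also have "\<dots> = K ys"
    unfolding w(2) m_def using cl by (simp add: G.m_assoc[symmetric] del: cocycle_word.simps)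
  finally have "K ys \<otimes>\<^bsub>G\<^esub> inv\<^bsub>G\<^esub> (gen x) = m \<otimes>\<^bsub>G\<^esub> (K ys \<otimes>\<^bsub>G\<^esub> gen ?x)"
    using cl m by (metis G.inv_solve_right' G.m_closed)
  then have "A \<otimes>\<^bsub>G\<^esub> inv\<^bsub>G\<^esub> (gen x) = n \<otimes>\<^bsub>G\<^esub> m \<otimes>\<^bsub>G\<^esub> K (?x # map (sol_f S ?x) ys)"
    unfolding cocycle_word_snoc_gen[OF x n(2), symmetric]
    using cl m n by (simp add: G.m_assoc)
  moreover have "set (?x # map (sol_f S ?x) ys) \<subseteq> X"
    using n x sol_closed[OF fin sol] by auto
  moreover have "n \<otimes>\<^bsub>G\<^esub> m \<in> ?N" using n m by simp
  ultimately show ?case by blast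
qed

text \<open>The first letter must occur again; permutation invariance brings the two copies
  together, and they split off as a frozen factor without changing any parity.\<close>

lemma cocycle_word_even:
  assumes C: "property_C X S"
  shows "set ys \<subseteq> X \<Longrightarrow> (\<And>z. even (count (mset ys) z)) \<Longrightarrow> K ys \<in> generate G (frozen_elements X S)"
proof (induction "length ys" arbitrary: ys rule: less_induct)
  case less
  show ?case
  proof (cases ys)
    case Nil
    then show ?thesis by (simp add: generate.one)
  next
    case (Cons y us)
    have "odd (count (mset us) y)" using less.prems(2)[of y] by (simp add: Cons)
    then have "y \<in># mset us" by (metis even_zero not_in_iff)
    then have us: "mset ys = mset (y # y # remove1 y us)" by (simp add: Cons)
    let ?zs = "remove1 y us"
    have zs: "set ?zs \<subseteq> X" "y \<in> X" using less.prems by (auto simp: Cons dest: notin_set_remove1)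
    have "even (count (mset ?zs) z)" for z
      using less.prems(2)[of z] unfolding us by (auto split: if_splits)
    moreover have "length ?zs < length ys" by (simp add: Cons length_remove1 less_Suc_eq_le)
    ultimately have "K ?zs \<in> generate G (frozen_elements X S)"
      using less.hyps zs by blast
    moreover have "K ys = K ?zs \<otimes>\<^bsub>G\<^esub> K [y, y]"
      using cocycle_word_mset[OF less.prems(1) us] cocycle_word_frozen[OF C zs(2,1)] by simp
    ultimately show ?thesis
      using generate.incl[OF cocycle_word_pair_frozen[OF zs(2)]] generate.eng by metis
  qed
qed

section \<open>The linear action on basis vectors\<close>

lemma psi_mult:
  assumes "A \<in> carrier G" "B \<in> carrier G" "v \<in> free_space X"
  shows "psi X S (A \<otimes>\<^bsub>G\<^esub> B) v = psi X S A (psi X S B v)"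
proof -
  note h = psi_hom[OF fin sol]
  show ?thesis
    using assms hom_in_carrier[OF h] by (simp add: hom_mult[OF h] GL_mult_apply compose_def)
qed

lemma basis_vec_free_space: "z \<in> X \<Longrightarrow> basis_vec z \<in> free_space X"
  by (auto simp: free_space_def intro: span_base)

lemma psi_scaleR:
  assumes "A \<in> carrier G" "v \<in> free_space X"
  shows "psi X S A (c *\<^sub>R v) = c *\<^sub>R psi X S A v"
  using hom_in_carrier[OF psi_hom[OF fin sol] assms(1)] assms(2) by (simp add: GL_def)

lemma psi_one_apply: "v \<in> free_space X \<Longrightarrow> psi X S \<one>\<^bsub>G\<^esub> v = v"
  using hom_one[OF psi_hom[OF fin sol] G.is_group group_GL[OF subspace_free_space]]
  by (simp add: GL_def BijGroup_def)

lemma psi_gen_basis_sign: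
  assumes "y \<in> X" "z \<in> X"
  shows "psi X S (gen y) (basis_vec z) = (if z = y then -1 else 1) *\<^sub>R basis_vec (\<phi> y z)"
  using assms psi_structure_gen[OF fin sol] psi_gen_basis[OF fin] by simp

text \<open>The rightmost generator \<open>gen y\<close> acts first, giving a sign exactly when z =
  y and moving z to \<open>\<phi> y z\<close>; the remaining letters are moved by the same map. Only
  the sign is tracked, so the image z' stays unspecified.\<close>

lemma psi_cocycle_word:
  assumes "set ys \<subseteq> X" "z \<in> X"
  shows "\<exists>z'\<in>X. psi X S (K ys) (basis_vec z) = (-1) ^ count (mset ys) z *\<^sub>R basis_vec z'"
  using assms
proof (induction "length ys" arbitrary: ys z)
  case 0
  then show ?case by (intro bexI[of _ z]) (simp_all add: psi_one_apply basis_vec_free_space)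
next
  case (Suc n)
  then obtain y us where ys: "ys = y # us" by (cases ys) auto
  let ?us = "map (\<phi> y) us"
  have us: "set ?us \<subseteq> X" "set us \<subseteq> X" "\<phi> y z \<in> X" "y \<in> X"
    using Suc.prems sol_phi_closed by (auto simp: ys)
  then obtain z' where z': "z' \<in> X" "psi X S (K ?us) (basis_vec (\<phi> y z)) =
      (-1) ^ count (mset ?us) (\<phi> y z) *\<^sub>R basis_vec z'"
    using Suc.hyps(1)[of ?us "\<phi> y z"] Suc.hyps(2) by (auto simp: ys)
  \<comment> \<open>Injectivity prevents another letter from being sent to
    \<open>\<phi> y z\<close>, so multiplicities are preserved.\<close>
  have "inj_on (\<phi> y) (insert z (set us))"
    using bij_sol_phi[OF us(4)] us(2) Suc.prems
    by (meson bij_betw_imp_inj_on inj_on_subset insert_subsetI)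
  then have "count (mset ?us) (\<phi> y z) = count (mset us) z"
    by (induction us) (auto simp: inj_on_def)
  then have "psi X S (K ys) (basis_vec z) = (-1) ^ count (mset ys) z *\<^sub>R basis_vec z'"
    using us z' Suc.prems
    by (simp add: ys psi_mult psi_scaleR psi_gen_basis_sign basis_vec_free_space
        cocycle_word_carrier structure_gen_carrier)
  then show ?case using z' by blast
qed

lemma cocycle_word_psi_one:
  assumes "set ys \<subseteq> X" and one: "psi X S (K ys) = \<one>\<^bsub>GL (free_space X)\<^esub>"
  shows "even (count (mset ys) z)"
proof (cases "z \<in> X")
  case True
  then obtain z' where "psi X S (K ys) (basis_vec z) = (-1) ^ count (mset ys) z *\<^sub>R basis_vec z'"
    using psi_cocycle_word[OF assms(1)] by blast
  then have "basis_vec z = (-1) ^ count (mset ys) z *\<^sub>R basis_vec z'"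
    using True by (simp add: one GL_def BijGroup_def basis_vec_free_space)
  \<comment> \<open>The coefficient of z is 1 on the left, but 0 or -1 on the right if the
    multiplicity is odd.\<close>
  then have "Poly_Mapping.lookup (basis_vec z) z =
      Poly_Mapping.lookup ((-1) ^ count (mset ys) z *\<^sub>R basis_vec z') z" by simp
  then show ?thesis
    by (cases "even (count (mset ys) z)") (auto simp: lookup_single when_def split: if_splits)
next
  case False
  then have "count (mset ys) z = 0" using assms(1) by (meson count_mset_0_iff subsetD)
  then show ?thesis by presburger
qed

lemma GL_eqI:
  assumes "T \<in> carrier (GL (free_space X))" "U \<in> carrier (GL (free_space X))"
    and basis: "\<And>z. z \<in> X \<Longrightarrow> T (basis_vec z) = U (basis_vec z)"
  shows "T = U"
proof (rule extensionalityI[of _ "free_space X"])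
  fix v assume "v \<in> free_space X"
  then have "v \<in> span (basis_vec ` X)" by (simp add: free_space_def)
  \<comment> \<open>Membership is carried along because linearity is known only on
    \<open>free_space X\<close>.\<close>
  then have "v \<in> free_space X \<and> T v = U v"
  proof (induction rule: span_induct_alt)
    case base
    have z: "0 \<in> free_space X" by (simp add: subspace_0 subspace_free_space)
    \<comment> \<open>The value at 0 comes from homogeneity with scalar 0.\<close>
    then have "T (0 *\<^sub>R 0) = 0 *\<^sub>R T 0" "U (0 *\<^sub>R 0) = 0 *\<^sub>R U 0"
      using assms(1,2) unfolding GL_def
      by (simp_all del: scaleR_zero_left scaleR_zero_right)
    with z show ?case by simp
  next
    case (step c b v)
    then have b: "b \<in> free_space X" "T b = U b"
      using basis basis_vec_free_space by auto
    then have "c *\<^sub>R b \<in> free_space X" by (simp add: subspace_scale subspace_free_space)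
    then show ?case using assms(1,2) b step by (simp add: GL_def subspace_add subspace_free_space)
  qed
  then show "T v = U v" ..
qed (use assms in \<open>auto simp: GL_def Bij_def\<close>)

text \<open>The two factors \<open>gen (\<phi> y y)\<close> and \<open>gen y\<close> permute the
  basis by mutually inverse maps. Their signs cancel: \<open>\<phi> y\<close> is injective, so both
  occur exactly at z = y.\<close>

lemma psi_frozen:
  assumes C: "property_C X S" and A: "A \<in> frozen_elements X S"
  shows "psi X S A = \<one>\<^bsub>GL (free_space X)\<^esub>"
proof (rule GL_eqI)
  interpret GLV: group "GL (free_space X)" by (rule group_GL[OF subspace_free_space])
  show "psi X S A \<in> carrier (GL (free_space X))"
    using A frozen_elements_carrier hom_in_carrier[OF psi_hom[OF fin sol]] by blast
  show "\<one>\<^bsub>GL (free_space X)\<^esub> \<in> carrier (GL (free_space X))" by simp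
  obtain y where y: "y \<in> X" "A = K [y, y]" using A by (rule frozen_elementsE)
  fix z assume z: "z \<in> X"
  have "\<phi> y z = \<phi> y y \<longleftrightarrow> z = y"
    using bij_sol_phi[OF y(1)] y z by (auto simp: bij_betw_def inj_on_def)
  then have "psi X S A (basis_vec z) = basis_vec z"
    using y z
    by (simp add: psi_mult psi_scaleR psi_gen_basis_sign basis_vec_free_space sol_phi_closed
        structure_gen_carrier sol_phi_frozen[OF C])
  then show "psi X S A (basis_vec z) = \<one>\<^bsub>GL (free_space X)\<^esub> (basis_vec z)"
    using z by (simp add: GL_def BijGroup_def basis_vec_free_space)
qed

lemma generate_frozen_le_kernel:
  assumes C: "property_C X S"
  shows "generate G (frozen_elements X S) \<subseteq> N_kernel X S"
proof (rule G.generate_subgroup_incl)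
  show "frozen_elements X S \<subseteq> N_kernel X S"
    using psi_frozen[OF C] frozen_elements_carrier
    by (auto simp: N_kernel_def kernel_def W_group_def)
  show "subgroup (N_kernel X S) G"
    using normal_N_kernel[OF fin sol] by (rule normal_imp_subgroup)
qed

lemma kernel_le_generate_frozen:
  assumes C: "property_C X S"
  shows "N_kernel X S \<subseteq> generate G (frozen_elements X S)"
proof
  let ?N = "generate G (frozen_elements X S)"
  interpret GLV: group "GL (free_space X)" by (rule group_GL[OF subspace_free_space])
  interpret N: subgroup ?N G by (rule G.generate_is_subgroup[OF frozen_elements_carrier])
  note h = psi_hom[OF fin sol]
  fix A assume "A \<in> N_kernel X S"
  then have A: "A \<in> carrier G" "psi X S A = \<one>\<^bsub>GL (free_space X)\<^esub>"
    by (auto simp: N_kernel_def kernel_def W_group_def)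
  then obtain n ys where n: "n \<in> ?N" "set ys \<subseteq> X" "A = n \<otimes>\<^bsub>G\<^esub> K ys"
    using structure_group_decomp[OF C] by blast
  \<comment> \<open>By the reverse inclusion \<open>n\<close> acts trivially, so the triviality of
    \<open>A\<close> passes to \<open>K ys\<close>.\<close>
  have "psi X S n = \<one>\<^bsub>GL (free_space X)\<^esub>"
    using n generate_frozen_le_kernel[OF C] by (auto simp: N_kernel_def kernel_def W_group_def)
  then have "psi X S (K ys) = \<one>\<^bsub>GL (free_space X)\<^esub>"
    using A(2) n hom_mult[OF h, of n "K ys"] hom_in_carrier[OF h, of "K ys"]
    by (simp add: cocycle_word_carrier)
  then have "K ys \<in> ?N"
    using cocycle_word_even[OF C n(2)] cocycle_word_psi_one[OF n(2)] by blast
  then show "A \<in> ?N" using n by simp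
qed

end

theorem proposition3p8:
  fixes X :: "'a set" and S :: "'a \<times> 'a \<Rightarrow> 'a \<times> 'a"
  assumes "finite X"
    and "nondegenerate_symmetric_solution X S"
    and "property_C X S"
  shows "N_kernel X S = generate (structure_group X S) (frozen_elements X S)"
  using kernel_le_generate_frozen[OF assms] generate_frozen_le_kernel[OF assms] by (rule equalityI)

end
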